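(* Let $f(z)=z+\sum_{n=2}^{\infty}a_nz^n\in T$, let $\lambda\ge1$ be real, and let $n,m\ge2$ be integers. (i) If $n=2$ and $m$ is even, then $|\lambda a_na_m-a_{n+m-1}|$ is bounded above by (a) $3+(2\lambda-1)(m-2)$ for $1\le\lambda\le 3/2$; (b) $2\lambda m-m-1$ for $\lambda\ge3/2$. (ii) If $m=2$ and $n$ is even, then $|\lambda a_na_m-a_{n+m-1}|$ is bounded above by (a) $3+(2\lambda-1)(n-2)$ for $1\le\lambda\le 3/2$; (b) $2\lambda n-n-1$ for $\lambda\ge3/2$. (iii) In all other cases, $|\lambda a_na_m-a_{n+m-1}|\le\lambda mn-n-m+1$. The bounds in (i)(b), (ii)(b) and (iii) are sharp (equality is attained by some function in $T$). The bounds in (i)(a) and (ii)(a) are sharp when $\lambda=1$, and also when $n=m=2$.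
   Context: $\mathbb{D}$ is the open unit disc and $\mathcal{A}$ is the class of analytic functions on $\mathbb{D}$ of the form $f(z)=z+a_2z^2+a_3z^3+\cdots$. $T$ is the class of typically real functions: all $f\in\mathcal{A}$ that take real values on the real axis (i.e. on $\mathbb{D}\cap\mathbb{R}$) and non-real values elsewhere in $\mathbb{D}$. *)

theory Defs
  imports "HOL-Complex_Analysis.Complex_Analysis"
begin

definition coeff0 :: "(complex \<Rightarrow> complex) \<Rightarrow> nat \<Rightarrow> complex" where
  "coeff0 f n = fps_nth (fps_expansion f 0) n"

text \<open>Only the values on the open unit disc matter below; the value of a function outside
  the disc is unconstrained.\<close>

definition class_A :: "(complex \<Rightarrow> complex) set" where
  "class_A = {f. f holomorphic_on ball 0 1 \<and> coeff0 f 0 = 0 \<and> coeff0 f 1 = 1}"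

definition typically_real :: "(complex \<Rightarrow> complex) set" where
  "typically_real =
     {f \<in> class_A. (\<forall>z \<in> ball 0 1. z \<in> \<real> \<longrightarrow> f z \<in> \<real>) \<and>
                   (\<forall>z \<in> ball 0 1. z \<notin> \<real> \<longrightarrow> f z \<notin> \<real>)}"

definition zalcman :: "real \<Rightarrow> nat \<Rightarrow> nat \<Rightarrow> (complex \<Rightarrow> complex) \<Rightarrow> complex" where
  "zalcman l n m f = of_real l * coeff0 f n * coeff0 f m - coeff0 f (n + m - 1)"

end

theory Submission
  imports Defs
begin

text \<open>
  The coefficients of a typically real function are averages
  \<open>a\<^sub>n = E[sin (n\<theta>) / sin \<theta>]\<close> over a probability distribution of the angle \<open>\<theta>\<close>.
  Put \<open>t\<^sub>k = E[cos (k\<theta>)]\<close>. Since \<open>sin ((k+1)\<theta>) - sin ((k-1)\<theta>) = 2 sin \<theta> cos (k\<theta>)\<close>,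
  these moments are half the differences: \<open>a\<^sub>k\<^sub>+\<^sub>1 - a\<^sub>k\<^sub>-\<^sub>1 = 2 t\<^sub>k\<close>. Everything rests on
  Livingston's inequality \<open>|2 t\<^sub>i t\<^sub>j - t\<^sub>i\<^sub>+\<^sub>j| \<le> 1\<close>, the
  analogue for moments of the coefficient functional: its modulus is largest for a point mass at
  \<open>\<theta> = 0\<close>.

  From it the coefficient bounds follow by summation. Increasing one index of
  \<open>a\<^sub>p\<^sub>+\<^sub>1 a\<^sub>q\<^sub>+\<^sub>1 - a\<^sub>p\<^sub>+\<^sub>q\<^sub>+\<^sub>1\<close> by two changes it by twice a mixed expression
  \<open>a\<^sub>p\<^sub>+\<^sub>1 t\<^sub>q - t\<^sub>p\<^sub>+\<^sub>q\<close>, and a second induction in steps of two bounds the latter by \<open>p\<close>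
  (\<open>abs_mixed_le\<close>). So for \<open>\<lambda> = 1\<close> the bound \<open>p q = (n-1)(m-1)\<close> propagates from the smallest
  indices of each parity. It starts at the value 0 when \<open>p\<close> or \<open>q\<close> is even, and for odd indices at
  least 3 it starts at \<open>p = q = 3\<close>, where \<open>a\<^sub>4\<^sup>2 - a\<^sub>7 \<ge> -7 \<ge> -9\<close>. Only \<open>p = 1\<close> with \<open>q\<close>
  odd (or conversely) is different: there \<open>a\<^sub>2\<^sup>2 - a\<^sub>3\<close> can be as small as -3, which produces the
  exceptional case \<open>n = 2\<close>, \<open>m\<close> even, with lower bound \<open>-(m+1)\<close>.

  For general \<open>\<lambda>\<close> only two values matter. By \<open>|a\<^sub>n| \<le> n\<close>, raising \<open>\<lambda>\<close> by \<open>h\<close> costs at most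
  \<open>h n m\<close>, which is exactly the growth of the claimed bounds above \<open>\<lambda> = 1\<close> in the generic case and
  above \<open>\<lambda> = 3/2\<close> in the exceptional one. The value \<open>\<lambda> = 3/2\<close> is settled by one more induction
  (\<open>three_halves_lower\<close>); between 1 and 3/2 the bound is the linear interpolation, because the
  modulus is convex in \<open>\<lambda>\<close>.

  The averages are realised without a representing measure on the unit circle. For a radius \<open>r < 1\<close>
  the function \<open>Im f(r e\<^sup>i\<^sup>\<theta>) sin \<theta>\<close> is a nonnegative weight because \<open>Im f\<close> and \<open>Im z\<close> have the same
  sign, and Cauchy's formula computes its cosine moments. Livingston's inequality for these moments
  passes to the limit \<open>r \<rightarrow> 1\<close>.

  Equality is attained by the Koebe function (\<open>a\<^sub>n = n\<close>, a point mass at \<open>\<theta> = 0\<close>), and, in the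
  exceptional case with \<open>\<lambda> = 1\<close> or \<open>m = 2\<close>, by its odd part, which has \<open>a\<^sub>2 = a\<^sub>m = 0\<close> and
  \<open>a\<^sub>m\<^sub>+\<^sub>1 = m + 1\<close>.
\<close>

section \<open>Coefficient inequalities from Livingston's inequality\<close>

text \<open>
  The sequence \<open>a\<close> stands for the coefficients and \<open>t\<close> for the cosine moments; the recursion is the
  addition formula for \<open>sin ((k+2)\<theta>) - sin (k\<theta>)\<close> divided by \<open>sin \<theta>\<close>.
\<close>

locale livingston_coefficients =
  fixes a t :: "nat \<Rightarrow> real"
  assumes a_0: "a 0 = 0"
    and a_1: "a (Suc 0) = 1"
    and t_0: "t 0 = 1"
    and a_step: "a (Suc (Suc k)) = a k + 2 * t (Suc k)"
    and livingston: "\<bar>2 * t i * t j - t (i + j)\<bar> \<le> 1"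
begin

lemma abs_t_le_1: "\<bar>t k\<bar> \<le> 1"
  using livingston[of k 0] by (simp add: t_0)

lemma abs_a_le: "\<bar>a k\<bar> \<le> real k"
proof (induction k rule: induct_nat_012)
  case (ge2 k)
  then show ?case
    using abs_t_le_1[of "Suc k"] by (simp add: a_step abs_le_iff)
qed (simp_all add: a_0 a_1)

text \<open>
  Passing from \<open>p\<close> to \<open>p + 2\<close> adds one Livingston expression and one moment, each at most 1 in modulus.
\<close>

lemma abs_mixed_le: "\<bar>a (Suc p) * t q - t (p + q)\<bar> \<le> real p"
proof (induction p rule: induct_nat_012)
  case 0
  then show ?case by (simp add: a_1)
next
  case 1
  then show ?case
    using livingston[of 1 q] by (simp add: a_step a_0)
next
  case (ge2 p)
  have "a (Suc (Suc (Suc p))) * t q - t (Suc (Suc p) + q) =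
      (a (Suc p) * t q - t (p + q)) + (2 * t (Suc (Suc p)) * t q - t (Suc (Suc p) + q)) + t (p + q)"
    by (simp add: a_step[of "Suc p"] algebra_simps)
  then show ?case
    using ge2 livingston[of "Suc (Suc p)" q] abs_t_le_1[of "p + q"] by (simp add: abs_le_iff)
qed

text \<open>
  The functional for \<open>\<lambda> = 1\<close>, with both indices shifted by one: the natural parameters are the degrees
  \<open>p = n - 1\<close> and \<open>q = m - 1\<close> of \<open>sin (n\<theta>) / sin \<theta>\<close> and \<open>sin (m\<theta>) / sin \<theta>\<close> as polynomials in
  \<open>cos \<theta>\<close>.
\<close>

definition Z :: "nat \<Rightarrow> nat \<Rightarrow> real" where
  "Z p q = a (Suc p) * a (Suc q) - a (Suc (p + q))"

lemma Z_commute: "Z p q = Z q p"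
  by (simp add: Z_def add.commute mult.commute)

lemma Z_0_right: "Z p 0 = 0"
  by (simp add: Z_def a_1)

lemma Z_Suc_Suc: "Z p (Suc (Suc q)) - Z p q = 2 * (a (Suc p) * t (q + 2) - t (p + (q + 2)))"
  by (simp add: Z_def a_step algebra_simps)

text \<open>
  Along a parity class \<open>Z\<close> cannot grow faster than the target bound \<open>p q\<close>, so the bound has to be
  verified only at the start of each class.
\<close>

lemma Z_add_even: "\<bar>Z p (q + 2 * k) - Z p q\<bar> \<le> 2 * real p * real k"
proof (induction k)
  case (Suc k)
  have "\<bar>Z p (Suc (Suc (q + 2 * k))) - Z p (q + 2 * k)\<bar> \<le> 2 * real p"
    unfolding Z_Suc_Suc using abs_mixed_le[of p "q + 2 * k + 2"] by (simp add: abs_mult)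
  with Suc show ?case by (simp add: abs_le_iff algebra_simps)
qed simp

text \<open>
  The lower bound -3 is attained by \<open>t\<^sub>1 = 0\<close>, \<open>t\<^sub>2 = 1\<close> (equal masses at \<open>\<theta> = 0\<close> and \<open>\<theta> = \<pi>\<close>);
  it is the source of the exceptional case.
\<close>

lemma Z_1_1_bounds: "Z 1 1 \<le> 1" "Z 1 1 \<ge> - 3"
proof -
  have *: "Z 1 1 = 2 * (2 * t 1 * t 1 - t 2) - 1" "Z 1 1 = 4 * (t 1)\<^sup>2 - 1 - 2 * t 2"
    using a_step[of 0] a_step[of 1] by (simp_all add: Z_def a_0 a_1 numeral_eq_Suc)
  show "Z 1 1 \<le> 1"
    using livingston[of 1 1, THEN abs_le_D1] unfolding *(1) one_add_one by simp
  show "Z 1 1 \<ge> - 3"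
    using abs_t_le_1[of 2] zero_le_power2[of "t 1"] unfolding *(2) abs_le_iff by linarith
qed

lemma abs_Z_le_even:
  assumes "even p \<or> even q"
  shows "\<bar>Z p q\<bar> \<le> real p * real q"
proof -
  have *: "\<bar>Z p (2 * k)\<bar> \<le> real p * real (2 * k)" for p k
    using Z_add_even[of p 0 k] by (simp add: Z_0_right)
  from assms show ?thesis
  proof
    assume "even q"
    then show ?thesis using *[of p "q div 2"] by simp
  next
    assume "even p"
    then show ?thesis using *[of q "p div 2"] by (simp add: Z_commute[of p q] mult.commute)
  qed
qed

lemma Z_1_odd_bounds:
  assumes "odd q"
  shows "Z 1 q \<le> real q" "Z 1 q \<ge> - (real q + 2)"
proof -
  obtain k where q: "q = 1 + 2 * k" using assms by (auto elim: oddE)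
  show "Z 1 q \<le> real q" "Z 1 q \<ge> - (real q + 2)"
    using Z_add_even[of 1 1 k] Z_1_1_bounds by (simp_all add: q abs_le_iff)
qed

lemma Z_upper: "Z p q \<le> real p * real q"
proof (cases "even p \<or> even q")
  case True
  then show ?thesis using abs_Z_le_even by (simp add: abs_le_iff)
next
  case False
  then obtain k where q: "q = 1 + 2 * k" by (auto elim: oddE)
  have "Z p 1 \<le> real p"
    using Z_1_odd_bounds(1)[of p] False by (simp add: Z_commute)
  then show ?thesis
    using Z_add_even[of p 1 k] by (simp add: q abs_le_iff algebra_simps)
qed

text \<open>
  Starting at \<open>q = 1\<close> would lose 2, as \<open>Z 1 1\<close> may be -3. Starting at \<open>q = 3\<close> loses nothing: the
  product in \<open>Z 3 3\<close> is a square, and \<open>a\<^sub>7 \<le> 7 \<le> 3 * 3\<close>.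
\<close>

lemma Z_3_odd_lower:
  assumes "odd q" "q \<ge> 3"
  shows "Z 3 q \<ge> - (3 * real q)"
proof -
  obtain k where q: "q = 3 + 2 * k"
    using assms by (metis add_diff_inverse_nat even_add evenE not_less odd_numeral)
  have "Z 3 3 \<ge> - 7"
    using abs_a_le[of 7] zero_le_square[of "a 4"]
    unfolding Z_def by (simp add: abs_le_iff del: zero_le_square)
  then show ?thesis
    using Z_add_even[of 3 3 k] by (simp add: q abs_le_iff)
qed

lemma Z_odd_lower:
  assumes "odd p" "odd q" "p \<ge> 3" "q \<ge> 3"
  shows "Z p q \<ge> - (real p * real q)"
proof -
  obtain k where q: "q = 3 + 2 * k"
    using assms by (metis add_diff_inverse_nat even_add evenE not_less odd_numeral)
  have "Z p 3 \<ge> - (3 * real p)"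
    using Z_3_odd_lower[of p] assms by (simp add: Z_commute)
  then show ?thesis
    using Z_add_even[of p 3 k] by (simp add: q abs_le_iff algebra_simps)
qed

lemma abs_Z_le:
  assumes "\<not> (p = 1 \<and> odd q)" "\<not> (q = 1 \<and> odd p)"
  shows "\<bar>Z p q\<bar> \<le> real p * real q"
proof (cases "even p \<or> even q")
  case False
  moreover from this assms have "p \<ge> 3" "q \<ge> 3"
    by (auto elim!: oddE)
  ultimately show ?thesis
    using Z_upper[of p q] Z_odd_lower[of p q] by (simp add: abs_le_iff)
qed (rule abs_Z_le_even)

text \<open>
  Raising \<open>k\<close> by one adds \<open>6 t\<^sub>1 t\<^sub>2\<^sub>k\<^sub>+\<^sub>3 - 2 t\<^sub>2\<^sub>k\<^sub>+\<^sub>4\<close>. This is twice a Livingston expression plus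
  \<open>2 t\<^sub>1 t\<^sub>2\<^sub>k\<^sub>+\<^sub>3\<close>, hence at least -4, which is just the decrease allowed.
\<close>

lemma three_halves_lower:
  "3 / 2 * a 2 * a (2 * k + 2) - a (2 * k + 3) \<ge> - (4 * real k + 3)"
proof (induction k)
  case 0
  have "a 2 = 2 * t 1" "a 3 = 1 + 2 * t 2"
    using a_step[of 0] a_step[of 1] by (simp_all add: a_0 a_1 numeral_eq_Suc)
  then have "3 / 2 * a 2 * a (2 * 0 + 2) - a (2 * 0 + 3) = 6 * (t 1 * t 1) - 1 - 2 * t 2"
    unfolding mult_0_right add_0 by simp
  then show ?case
    using abs_t_le_1[of 2] zero_le_square[of "t 1"]
    unfolding abs_le_iff by (simp del: zero_le_square)
next
  case (Suc k)
  have a2: "a 2 = 2 * t 1"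
    using a_step[of 0] by (simp add: a_0 numeral_eq_Suc)
  have up: "a (2 * Suc k + 2) = a (2 * k + 2) + 2 * t (2 * k + 3)"
    "a (2 * Suc k + 3) = a (2 * k + 3) + 2 * t (2 * k + 4)"
    using a_step[of "2 * k + 2"] a_step[of "2 * k + 3"] by (simp_all add: numeral_eq_Suc)
  have "\<bar>t 1 * t (2 * k + 3)\<bar> \<le> 1 * 1"
    unfolding abs_mult by (intro mult_mono abs_t_le_1) auto
  moreover have "\<bar>2 * t 1 * t (2 * k + 3) - t (2 * k + 4)\<bar> \<le> 1"
    using livingston[of 1 "2 * k + 3"] by (simp add: numeral_eq_Suc)
  ultimately have "6 * (t 1 * t (2 * k + 3)) - 2 * t (2 * k + 4) \<ge> - 4"
    by (simp add: abs_le_iff)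
  then show ?case
    using Suc unfolding up a2 by (simp add: algebra_simps)
qed

text \<open>
  Above, the bound \<open>m - 1\<close> for factor 1 suffices, since half of \<open>a\<^sub>2 a\<^sub>m\<close> adds at most \<open>m\<close>. Below, the
  same argument would start from \<open>-(m+1)\<close> and miss the target by 2.
\<close>

lemma abs_three_halves_le:
  assumes "even m" "m \<ge> 2"
  shows "\<bar>3 / 2 * (a 2 * a m) - a (m + 1)\<bar> \<le> 2 * real m - 1"
proof -
  obtain k where m: "m = 2 * k + 2"
    using assms by (metis add.commute dvd_diff_nat evenE le_add_diff_inverse dvd_refl)
  have "\<bar>a 2 * a m\<bar> \<le> 2 * real m"
    unfolding abs_mult using abs_a_le[of 2] abs_a_le[of m] by (intro mult_mono) auto
  moreover have "a 2 * a m - a (m + 1) \<le> real m - 1"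
    using Z_upper[of 1 "2 * k + 1"] by (simp add: Z_def m numeral_eq_Suc)
  ultimately have "3 / 2 * (a 2 * a m) - a (m + 1) \<le> 2 * real m - 1"
    by (simp add: abs_le_iff)
  moreover have "3 / 2 * (a 2 * a m) - a (m + 1) \<ge> - (2 * real m - 1)"
    using three_halves_lower[of k] by (simp add: m numeral_3_eq_3)
  ultimately show ?thesis by (simp add: abs_le_iff)
qed

theorem zalcman_bound_generic:
  assumes "l \<ge> 1" "n \<ge> 1" "m \<ge> 1" "\<not> (n = 2 \<and> even m)" "\<not> (m = 2 \<and> even n)"
  shows "\<bar>l * (a n * a m) - a (n + m - 1)\<bar> \<le> l * real m * real n - real n - real m + 1"
proof -
  obtain p q where n: "n = Suc p" and m: "m = Suc q"
    using assms by (metis Suc_le_D One_nat_def)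
  have "\<bar>a n * a m - a (n + m - 1)\<bar> \<le> (real n - 1) * (real m - 1)"
    using abs_Z_le[of p q] assms by (simp add: Z_def n m)
  moreover have "\<bar>(l - 1) * (a n * a m)\<bar> \<le> (l - 1) * (real n * real m)"
    unfolding abs_mult using assms abs_a_le[of n] abs_a_le[of m]
    by (intro mult_mono) auto
  ultimately show ?thesis by (simp add: abs_le_iff algebra_simps)
qed

text \<open>
  For \<open>l\<close> between 1 and 3/2, the functional and the bound are both the combination of their values at
  1 and 3/2 with weights \<open>3 - 2 l\<close> and \<open>2 l - 2\<close>.
\<close>

theorem zalcman_bound_exceptional:
  assumes "even m" "m \<ge> 2" "l \<ge> 1"
  shows "l \<le> 3 / 2 \<Longrightarrow> \<bar>l * (a 2 * a m) - a (m + 1)\<bar> \<le> 3 + (2 * l - 1) * (real m - 2)"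
    and "l \<ge> 3 / 2 \<Longrightarrow> \<bar>l * (a 2 * a m) - a (m + 1)\<bar> \<le> 2 * l * real m - real m - 1"
proof -
  let ?x = "a 2 * a m" and ?y = "a (m + 1)"
  have three_halves: "\<bar>3 / 2 * ?x - ?y\<bar> \<le> 2 * real m - 1"
    using assms by (intro abs_three_halves_le)
  {
    assume l: "l \<le> 3 / 2"
    obtain q where q: "m = Suc q" "odd q"
      using assms by (cases m) auto
    have "\<bar>?x - ?y\<bar> \<le> real m + 1"
      using Z_1_odd_bounds[OF q(2)] by (simp add: Z_def q(1) abs_le_iff numeral_2_eq_2)
    then have one: "\<bar>(3 - 2 * l) * (?x - ?y)\<bar> \<le> (3 - 2 * l) * (real m + 1)"
      unfolding abs_mult using l by (intro mult_mono) auto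
    have two: "\<bar>(2 * l - 2) * (3 / 2 * ?x - ?y)\<bar> \<le> (2 * l - 2) * (2 * real m - 1)"
      unfolding abs_mult using assms three_halves by (intro mult_mono) auto
    have "l * ?x - ?y = (3 - 2 * l) * (?x - ?y) + (2 * l - 2) * (3 / 2 * ?x - ?y)"
      by (simp add: field_simps)
    moreover have "3 + (2 * l - 1) * (real m - 2) =
        (3 - 2 * l) * (real m + 1) + (2 * l - 2) * (2 * real m - 1)"
      by (simp add: algebra_simps)
    ultimately show "\<bar>l * ?x - ?y\<bar> \<le> 3 + (2 * l - 1) * (real m - 2)"
      using one two by linarith
  next
    assume l: "l \<ge> 3 / 2"
    have "\<bar>(l - 3 / 2) * ?x\<bar> \<le> (l - 3 / 2) * (2 * real m)"
      unfolding abs_mult using l abs_a_le[of 2] abs_a_le[of m] by (intro mult_mono) auto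
    then show "\<bar>l * ?x - ?y\<bar> \<le> 2 * l * real m - real m - 1"
      using three_halves by (simp add: abs_le_iff algebra_simps)
  }
qed

end

section \<open>Livingston's inequality for the moments of a weight on the circle\<close>

text \<open>
  Let \<open>E\<close> be the average with weight \<open>w\<close>, \<open>A = i\<theta>\<close>, \<open>B = j\<theta>\<close> and \<open>\<epsilon> = \<plusminus>1\<close>. Pointwise,
  \<open>1 + \<epsilon> cos (A + B) - (cos A + \<epsilon> cos B)\<^sup>2 / 2 = (sin A - \<epsilon> sin B)\<^sup>2 / 2 \<ge> 0\<close>. Averaging and using
  \<open>E[X\<^sup>2] \<ge> E[X]\<^sup>2\<close> gives \<open>1 + \<epsilon> \<tau>\<^sub>i\<^sub>+\<^sub>j \<ge> (\<tau>\<^sub>i + \<epsilon> \<tau>\<^sub>j)\<^sup>2 / 2 \<ge> 2 \<epsilon> \<tau>\<^sub>i \<tau>\<^sub>j\<close>. The two choices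
  of \<open>\<epsilon>\<close> are the two sides of the inequality.
\<close>

lemma livingston_weight:
  fixes w :: "real \<Rightarrow> real" and \<tau> :: "nat \<Rightarrow> real"
  assumes nonneg: "\<And>x. x \<in> {0..1} \<Longrightarrow> w x \<ge> 0"
    and moment: "\<And>k. ((\<lambda>x. w x * cos (real k * (2 * pi * x))) has_integral \<tau> k) {0..1}"
    and mass: "\<tau> 0 = 1"
  shows "\<bar>2 * \<tau> i * \<tau> j - \<tau> (i + j)\<bar> \<le> 1"
proof -
  have *: "\<epsilon> * (2 * \<tau> i * \<tau> j - \<tau> (i + j)) \<le> 1" if \<epsilon>: "\<epsilon> = 1 \<or> \<epsilon> = - 1" for \<epsilon> :: real
  proof -
    have \<epsilon>2: "\<epsilon> * \<epsilon> = 1" using \<epsilon> by auto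
    \<comment> \<open>The square of a random variable is replaced by its tangent at the mean s, so that
      only the cosine moments themselves have to be integrated.\<close>
    define s where "s = \<tau> i + \<epsilon> * \<tau> j"
    let ?c = "\<lambda>k x. cos (real k * (2 * pi * x))"
    let ?g = "\<lambda>x. w x * ?c 0 x * (1 + s\<^sup>2 / 2) + w x * ?c (i + j) x * \<epsilon>
      - w x * ?c i x * s - w x * ?c j x * (s * \<epsilon>)"
    have "(?g has_integral \<tau> 0 * (1 + s\<^sup>2 / 2) + \<tau> (i + j) * \<epsilon> - \<tau> i * s - \<tau> j * (s * \<epsilon>)) {0..1}"
      by (intro has_integral_add has_integral_diff has_integral_mult_left moment)
    moreover have "?g x \<ge> 0" if "x \<in> {0..1}" for x
    proof -
      define A B where "A = real i * (2 * pi * x)" and "B = real j * (2 * pi * x)"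
      have pythagoras: "cos A * cos A + (cos B * cos B + (sin A * sin A + sin B * sin B)) = 2"
        by (simp flip: power2_eq_square add: sin_squared_eq)
      have cos_sum: "?c (i + j) x = cos A * cos B - sin A * sin B"
        by (simp add: A_def B_def cos_add[symmetric] algebra_simps)
      \<comment> \<open>Completing the square, first in s and then in the sines.\<close>
      have "1 + s\<^sup>2 / 2 + (cos A * cos B - sin A * sin B) * \<epsilon> - cos A * s - cos B * (s * \<epsilon>) =
          ((s - (cos A + \<epsilon> * cos B))\<^sup>2 + (sin A - \<epsilon> * sin B)\<^sup>2) / 2"
        using \<epsilon> by (elim disjE) (simp_all add: power2_eq_square algebra_simps pythagoras)
      also have "\<dots> \<ge> 0" by simp
      finally have "0 \<le> w x * (1 + s\<^sup>2 / 2 + ?c (i + j) x * \<epsilon> - ?c i x * s - ?c j x * (s * \<epsilon>))"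
        using nonneg[OF that] unfolding cos_sum by (simp add: A_def B_def)
      then show ?thesis by (simp add: algebra_simps)
    qed
    ultimately have "0 \<le> \<tau> 0 * (1 + s\<^sup>2 / 2) + \<tau> (i + j) * \<epsilon> - \<tau> i * s - \<tau> j * (s * \<epsilon>)"
      by (rule has_integral_nonneg) auto
    also have "\<dots> = 1 + \<epsilon> * \<tau> (i + j) - s\<^sup>2 / 2"
      using \<epsilon>2 by (simp add: mass s_def power2_eq_square algebra_simps)
    also have "s\<^sup>2 / 2 = 2 * \<epsilon> * \<tau> i * \<tau> j + (\<tau> i - \<epsilon> * \<tau> j)\<^sup>2 / 2"
      by (simp add: s_def power2_eq_square field_simps)
    finally have "0 \<le> 1 + \<epsilon> * \<tau> (i + j) - (2 * \<epsilon> * \<tau> i * \<tau> j + (\<tau> i - \<epsilon> * \<tau> j)\<^sup>2 / 2)" .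
    moreover have "\<epsilon> * (2 * \<tau> i * \<tau> j - \<tau> (i + j)) = 2 * \<epsilon> * \<tau> i * \<tau> j - \<epsilon> * \<tau> (i + j)"
      by (simp add: algebra_simps)
    ultimately show ?thesis
      using zero_le_power2[of "\<tau> i - \<epsilon> * \<tau> j"] by linarith
  qed
  from *[of 1] *[of "-1"] show ?thesis by (simp add: abs_le_iff)
qed

section \<open>Fourier coefficients of a holomorphic function on a circle\<close>

lemma coeff0_eq: "coeff0 f n = (deriv ^^ n) f 0 / fact n"
  by (simp add: coeff0_def fps_expansion_def)

abbreviation circ :: "real \<Rightarrow> real \<Rightarrow> complex" where
  "circ r x \<equiv> of_real r * cis (2 * pi * x)"

lemma circlepath_eq_circ: "circlepath 0 r x = circ r x"
  by (simp add: circlepath cis_conv_exp mult.commute mult.left_commute)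

lemma has_contour_integral_circ:
  assumes "(g has_contour_integral I) (circlepath 0 r)"
  shows "((\<lambda>x. g (circ r x) * circ r x) has_integral I / (2 * pi * \<i>)) {0..1}"
proof -
  have "((\<lambda>x. g (circ r x) * (2 * pi * \<i> * circ r x)) has_integral I) {0..1}"
    using assms unfolding has_contour_integral_def
    by (rule has_integral_eq[rotated])
      (simp add: vector_derivative_circlepath01 circlepath_eq_circ cis_conv_exp mult_ac)
  from has_integral_mult_left[OF this, of "1 / (2 * pi * \<i>)"] show ?thesis
    by (simp add: field_simps)
qed

context
  fixes f :: "complex \<Rightarrow> complex" and r :: real
  assumes hol: "f holomorphic_on ball 0 1" and r: "0 < r" "r < 1"
begin

lemma fourier_coeff_nonneg:
  "((\<lambda>x. f (circ r x) * cis (- (real n * (2 * pi * x)))) has_integral coeff0 f n * r ^ n) {0..1}"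
proof -
  have "f holomorphic_on cball 0 r"
    using hol by (rule holomorphic_on_subset) (use r in auto)
  then have "((\<lambda>u. f u / (u - 0) ^ Suc n) has_contour_integral
      (2 * pi * \<i>) / fact n * (deriv ^^ n) f 0) (circlepath 0 r)"
    using r by (intro Cauchy_has_contour_integral_higher_derivative_circlepath)
      (auto intro: holomorphic_on_imp_continuous_on elim: holomorphic_on_subset)
  from has_integral_mult_left[OF has_contour_integral_circ[OF this], of "of_real r ^ n"]
  have "((\<lambda>x. f (circ r x) / circ r x ^ Suc n * circ r x * of_real r ^ n)
      has_integral coeff0 f n * r ^ n) {0..1}"
    by (simp add: coeff0_eq)
  moreover have "f (circ r x) / circ r x ^ Suc n * circ r x * of_real r ^ n =
      f (circ r x) * cis (- (real n * (2 * pi * x)))" for x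
    using r by (simp add: power_mult_distrib Complex.DeMoivre cis_divide[symmetric] field_simps flip: cis_inverse)
  ultimately show ?thesis by simp
qed

lemma fourier_coeff_neg:
  assumes "n \<ge> 1"
  shows "((\<lambda>x. f (circ r x) * cis (real n * (2 * pi * x))) has_integral 0) {0..1}"
proof -
  have "((\<lambda>u. f u * u ^ (n - 1)) has_contour_integral 0) (circlepath 0 r)"
    using r hol by (intro Cauchy_theorem_disc_simple[of _ 0 1]) (auto intro!: holomorphic_intros)
  from has_integral_mult_left[OF has_contour_integral_circ[OF this], of "1 / of_real r ^ n"]
  have "((\<lambda>x. f (circ r x) * circ r x ^ (n - 1) * circ r x / of_real r ^ n) has_integral 0) {0..1}"
    by simp
  moreover have "f (circ r x) * circ r x ^ (n - 1) * circ r x / of_real r ^ n =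
      f (circ r x) * cis (real n * (2 * pi * x))" for x
  proof -
    have "circ r x ^ (n - 1) * circ r x = circ r x ^ n"
      using assms by (cases n) auto
    also have "\<dots> = of_real r ^ n * cis (real n * (2 * pi * x))"
      by (simp add: power_mult_distrib Complex.DeMoivre)
    finally show ?thesis using r by (simp add: field_simps)
  qed
  ultimately show ?thesis by simp
qed

text \<open>
  Since \<open>sin\<close> is real, \<open>Im\<close> can be taken after integration of \<open>f\<close> against
  \<open>(e\<^sup>i\<^sup>n\<^sup>\<theta> - e\<^sup>-\<^sup>i\<^sup>n\<^sup>\<theta>) / 2i\<close>. Only the second exponential meets the power series of \<open>f\<close>, which
  has no negative frequencies.
\<close>

lemma fourier_sine_Im:
  assumes "coeff0 f 0 = 0"
  shows "((\<lambda>x. Im (f (circ r x)) * sin (real n * (2 * pi * x)))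
           has_integral Re (coeff0 f n) * r ^ n / 2) {0..1}"
proof (cases "n = 0")
  case True
  then show ?thesis using assms by simp
next
  case False
  have "((\<lambda>x. (f (circ r x) * cis (real n * (2 * pi * x)) - f (circ r x) * cis (- (real n * (2 * pi * x))))
      * (1 / (2 * \<i>))) has_integral (0 - coeff0 f n * r ^ n) * (1 / (2 * \<i>))) {0..1}"
    using False by (intro has_integral_mult_left has_integral_diff fourier_coeff_nonneg fourier_coeff_neg) auto
  moreover have "(f (circ r x) * cis (real n * (2 * pi * x)) - f (circ r x) * cis (- (real n * (2 * pi * x))))
      * (1 / (2 * \<i>)) = f (circ r x) * of_real (sin (real n * (2 * pi * x)))" for x
    by (simp add: complex_eq_iff)
  ultimately have "((\<lambda>x. f (circ r x) * of_real (sin (real n * (2 * pi * x))))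
      has_integral (0 - coeff0 f n * r ^ n) * (1 / (2 * \<i>))) {0..1}"
    by simp
  from has_integral_linear[OF this bounded_linear_Im] show ?thesis
    by (simp add: o_def Re_power_real)
qed

end

section \<open>Typically real functions\<close>

lemma typically_realD:
  assumes "f \<in> typically_real"
  shows "f holomorphic_on ball 0 1" "coeff0 f 0 = 0" "coeff0 f 1 = 1"
    "norm z < 1 \<Longrightarrow> z \<in> \<real> \<Longrightarrow> f z \<in> \<real>" "norm z < 1 \<Longrightarrow> z \<notin> \<real> \<Longrightarrow> f z \<notin> \<real>"
  using assms by (auto simp: typically_real_def class_A_def)

text \<open>
  On an open half-disc \<open>Im f\<close> is continuous without zeros, so it has constant sign there. Near the origin
  \<open>f z\<close> behaves like \<open>z\<close>, which identifies the sign.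
\<close>

lemma typically_real_Im_nonneg:
  assumes f: "f \<in> typically_real" and z: "norm z < 1"
  shows "Im (f z) * Im z \<ge> 0"
proof (rule ccontr)
  assume neg: "\<not> Im (f z) * Im z \<ge> 0"
  define s where "s = sgn (Im z)"
  have s: "s = 1 \<or> s = - 1" using neg by (auto simp: s_def sgn_if)
  define H where "H = ball 0 1 \<inter> {w. s * Im w > 0}"
  define g where "g = (\<lambda>w. s * Im (f w))"
  have hol: "f holomorphic_on ball 0 1" by (rule typically_realD(1)[OF f])
  have "{w. s * Im w > 0} = (if s = 1 then {w. Im w > 0} else {w. Im w < 0})"
    using s by auto
  then have "convex {w. s * Im w > 0}"
    by (simp add: convex_halfspace_Im_gt convex_halfspace_Im_lt)
  then have "convex H"
    unfolding H_def by (intro convex_Int convex_ball)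
  then have "connected H" by (rule convex_connected)
  moreover have "continuous_on H g"
    unfolding g_def H_def
    by (intro continuous_intros continuous_on_subset[OF holomorphic_on_imp_continuous_on[OF hol]]) auto
  ultimately have conn: "connected (g ` H)" by (rule connected_continuous_image[rotated])
  have g_nz: "g w \<noteq> 0" if "w \<in> H" for w
    using typically_realD(5)[OF f, of w] that s by (auto simp: g_def H_def complex_is_Real_iff)
  have zH: "z \<in> H" "g z < 0"
    using z neg by (auto simp: H_def g_def s_def sgn_if not_le mult_less_0_iff)
  have g_neg: "g w < 0" if "w \<in> H" for w
  proof (rule ccontr)
    assume "\<not> g w < 0"
    then have "0 \<in> g ` H"
      using connectedD_interval[OF conn, of "g z" "g w" 0] zH that by auto
    then show False using g_nz by auto
  qed
  have "deriv f 0 = 1"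
    using typically_realD(3)[OF f] by (simp add: coeff0_eq)
  then have "(f has_field_derivative 1) (at 0)"
    using holomorphic_derivI[OF hol, of 0] by simp
  moreover have "f 0 = 0" using typically_realD(2)[OF f] by (simp add: coeff0_eq)
  ultimately have lim: "((\<lambda>h. f h / h) \<longlongrightarrow> 1) (at 0)"
    by (simp add: DERIV_def)
  \<comment> \<open>Approach the origin along the imaginary axis, inside the half-disc.\<close>
  have "filterlim (\<lambda>y. Complex 0 (s * y)) (at 0) (at_right 0)"
    unfolding filterlim_at
  proof
    show "((\<lambda>y. Complex 0 (s * y)) \<longlongrightarrow> 0) (at_right 0)"
      by (rule tendsto_eq_intros refl | simp add: complex_eq_iff)+
    show "\<forall>\<^sub>F y in at_right 0. Complex 0 (s * y) \<in> UNIV \<and> Complex 0 (s * y) \<noteq> 0"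
      using s by (auto simp: eventually_at_filter complex_eq_iff)
  qed
  from tendsto_Re[OF filterlim_compose[OF lim this]]
  have "((\<lambda>y. Re (f (Complex 0 (s * y)) / Complex 0 (s * y))) \<longlongrightarrow> 1) (at_right 0)"
    by simp
  then have "\<forall>\<^sub>F y in at_right 0. Re (f (Complex 0 (s * y)) / Complex 0 (s * y)) > 0"
    by (rule order_tendstoD) simp
  moreover have "\<forall>\<^sub>F y in at_right (0::real). 0 < y \<and> y < 1"
    by (intro eventually_conj eventually_at_right_less eventually_at_right_real[of 0 1, THEN eventually_mono]) auto
  ultimately have "\<forall>\<^sub>F y in at_right (0::real). False"
  proof eventually_elim
    case (elim y)
    have "Complex 0 (s * y) \<in> H"
      using elim s by (auto simp: H_def complex_norm)
    from g_neg[OF this] have "s * Im (f (Complex 0 (s * y))) < 0" by (simp add: g_def)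
    moreover have "Re (f (Complex 0 (s * y)) / Complex 0 (s * y)) = s * Im (f (Complex 0 (s * y))) / y"
      using elim s by (auto simp: Re_divide power2_eq_square field_simps)
    ultimately show False using elim by (simp add: zero_less_divide_iff)
  qed
  then show False by simp
qed

lemma typically_real_coeff_real:
  assumes f: "f \<in> typically_real"
  shows "coeff0 f n = of_real (Re (coeff0 f n))"
proof -
  have "Im (coeff0 f n) = 0"
  proof (rule ccontr)
    assume nz: "Im (coeff0 f n) \<noteq> 0"
    then have "n > 0" using typically_realD(2)[OF f] by (cases n) auto
    have sums: "(\<lambda>n. Im (coeff0 f n) * (x - 0) ^ n) sums 0" if "norm (x - 0) < 1" for x :: real
    proof -
      have "(\<lambda>n. coeff0 f n * (of_real x - 0) ^ n) sums f (of_real x)"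
        unfolding coeff0_eq
        by (rule holomorphic_power_series[OF typically_realD(1)[OF f]]) (use that in auto)
      from sums_Im[OF this] have "(\<lambda>n. Im (coeff0 f n) * x ^ n) sums Im (f (of_real x))"
        by (simp flip: of_real_power)
      moreover have "f (of_real x) \<in> \<real>"
        using typically_realD(4)[OF f] that by simp
      ultimately show ?thesis by (simp add: complex_is_Real_iff)
    qed
    \<comment> \<open>A real power series with a nonzero coefficient would have an isolated zero at the origin.\<close>
    show False
    proof (rule powser_0_nonzero[of 1 0 "\<lambda>n. Im (coeff0 f n)" "\<lambda>_. 0" n, OF _ sums _ nz \<open>n > 0\<close>])
      fix s :: real
      assume "0 < s" and "\<And>z::real. z \<in> cball 0 s - {0} \<Longrightarrow> (0::real) \<noteq> 0"
      from this(2)[of s] \<open>0 < s\<close> show False by simp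
    qed simp_all
  qed
  then show ?thesis by (simp add: complex_eq_iff)
qed

text \<open>
  The cosine moments of the weight \<open>(2/r) Im f(r e\<^sup>i\<^sup>\<theta>) sin \<theta>\<close>, normalised to mass 1. As they are given
  by coefficients, the expression also makes sense for \<open>r = 1\<close>, to which \<open>f\<close> itself need not extend.
\<close>

definition circle_moment :: "(complex \<Rightarrow> complex) \<Rightarrow> real \<Rightarrow> nat \<Rightarrow> real" where
  "circle_moment f r k = (if k = 0 then 1 else
     (Re (coeff0 f (k + 1)) * r ^ (k + 1) - Re (coeff0 f (k - 1)) * r ^ (k - 1)) / (2 * r))"

lemma circle_moment_has_integral:
  assumes f: "f \<in> typically_real" and r: "0 < r" "r < 1"
  shows "((\<lambda>x. 2 / r * (Im (f (circ r x)) * sin (2 * pi * x)) * cos (real k * (2 * pi * x)))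
           has_integral circle_moment f r k) {0..1}"
proof -
  note sine = fourier_sine_Im[OF typically_realD(1)[OF f] r typically_realD(2)[OF f]]
  show ?thesis
  proof (cases "k = 0")
    case True
    with has_integral_mult_right[OF sine[of 1], of "2 / r"] r typically_realD(3)[OF f]
    show ?thesis by (simp add: circle_moment_def mult_ac)
  next
    case False
    have "((\<lambda>x. (Im (f (circ r x)) * sin (real (k + 1) * (2 * pi * x))
          - Im (f (circ r x)) * sin (real (k - 1) * (2 * pi * x))) * (1 / r))
        has_integral (Re (coeff0 f (k + 1)) * r ^ (k + 1) / 2 - Re (coeff0 f (k - 1)) * r ^ (k - 1) / 2)
          * (1 / r)) {0..1}"
      by (intro has_integral_mult_left has_integral_diff sine)
    moreover have "(Im (f (circ r x)) * sin (real (k + 1) * (2 * pi * x))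
          - Im (f (circ r x)) * sin (real (k - 1) * (2 * pi * x))) * (1 / r) =
        2 / r * (Im (f (circ r x)) * sin (2 * pi * x)) * cos (real k * (2 * pi * x))" for x
    proof -
      define u v where "u = real k * (2 * pi * x)" and "v = 2 * pi * x"
      have "real (k + 1) * (2 * pi * x) = u + v" "real (k - 1) * (2 * pi * x) = u - v"
        using False by (simp_all add: u_def v_def of_nat_diff algebra_simps)
      moreover have "sin (u + v) - sin (u - v) = 2 * sin v * cos u"
        by (simp add: sin_add sin_diff)
      ultimately show ?thesis
        by (simp only: flip: right_diff_distrib) (simp add: u_def v_def)
    qed
    ultimately show ?thesis
      using False by (simp add: circle_moment_def diff_divide_distrib)
  qed
qed

text \<open>
  For \<open>r < 1\<close> the moments belong to a nonnegative weight and obey Livingston's inequality. They depend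
  continuously on \<open>r\<close>, and at \<open>r = 1\<close> they satisfy the recursion for the coefficients.
\<close>

lemma typically_real_livingston:
  assumes f: "f \<in> typically_real"
  shows "livingston_coefficients (\<lambda>n. Re (coeff0 f n)) (circle_moment f 1)"
proof
  fix i j :: nat
  have lim: "((\<lambda>r. circle_moment f r k) \<longlongrightarrow> circle_moment f 1 k) (at_left 1)" for k
    unfolding circle_moment_def
    by (cases "k = 0") (simp, simp only: if_False, intro tendsto_intros, simp)
  show "\<bar>2 * circle_moment f 1 i * circle_moment f 1 j - circle_moment f 1 (i + j)\<bar> \<le> 1"
  proof (rule tendsto_upperbound)
    show "((\<lambda>r. \<bar>2 * circle_moment f r i * circle_moment f r j - circle_moment f r (i + j)\<bar>) \<longlongrightarrow>
        \<bar>2 * circle_moment f 1 i * circle_moment f 1 j - circle_moment f 1 (i + j)\<bar>) (at_left 1)"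
      by (intro tendsto_intros lim)
    have "\<forall>\<^sub>F r in at_left (1::real). r \<in> {0<..<1}"
      by (rule eventually_at_left_real) simp
    then show "\<forall>\<^sub>F r in at_left 1.
        \<bar>2 * circle_moment f r i * circle_moment f r j - circle_moment f r (i + j)\<bar> \<le> 1"
    proof eventually_elim
      case (elim r)
      then have r: "0 < r" "r < 1" by auto
      show ?case
      proof (rule livingston_weight[OF _ circle_moment_has_integral[OF f r]])
        show "circle_moment f r 0 = 1" by (simp add: circle_moment_def)
        fix x :: real
        have "Im (f (circ r x)) * Im (circ r x) \<ge> 0"
          using r by (intro typically_real_Im_nonneg[OF f]) (simp add: norm_mult)
        then show "2 / r * (Im (f (circ r x)) * sin (2 * pi * x)) \<ge> 0"
          using r by (auto simp: zero_le_mult_iff zero_le_divide_iff mult_le_0_iff)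
      qed
    qed
  qed auto
qed (use typically_realD(2,3)[OF f] in \<open>simp_all add: circle_moment_def field_simps\<close>)

lemma norm_zalcman_eq:
  assumes "f \<in> typically_real"
  shows "norm (zalcman l n m f) =
    \<bar>l * (Re (coeff0 f n) * Re (coeff0 f m)) - Re (coeff0 f (n + m - 1))\<bar>"
proof -
  have "zalcman l n m f =
      of_real (l * (Re (coeff0 f n) * Re (coeff0 f m)) - Re (coeff0 f (n + m - 1)))"
    unfolding zalcman_def
    by (subst (1 2 3) typically_real_coeff_real[OF assms]) (simp add: mult.assoc)
  then show ?thesis by (metis norm_of_real real_norm_def)
qed

section \<open>Extremal functions\<close>

definition koebe :: "complex \<Rightarrow> complex" where
  "koebe z = z / (1 - z)\<^sup>2"

definition odd_koebe :: "complex \<Rightarrow> complex" where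
  "odd_koebe z = (koebe z - koebe (- z)) / 2"

lemma koebe_sums:
  assumes "norm z < 1"
  shows "(\<lambda>n. of_nat n * z ^ n) sums koebe z"
proof -
  have "(\<lambda>n. z * (of_nat (Suc n) * z ^ n)) sums (z * (1 / (1 - z)\<^sup>2))"
    by (intro sums_mult geometric_deriv_sums assms)
  then have "(\<lambda>n. of_nat (Suc n) * z ^ Suc n) sums koebe z"
    by (simp add: koebe_def mult_ac)
  then show ?thesis by (subst (asm) sums_Suc_iff) simp
qed

lemma coeff0_eqI:
  assumes "\<And>z. norm z < 1 \<Longrightarrow> (\<lambda>n. c n * z ^ n) sums f z"
  shows "coeff0 f n = c n"
proof -
  have "\<forall>\<^sub>F z in nhds (0::complex). z \<in> ball 0 1"
    by (intro eventually_nhds_in_open) auto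
  then have "f has_fps_expansion Abs_fps c"
    by (intro has_fps_expansionI) (auto elim!: eventually_mono intro: assms)
  then show ?thesis
    by (simp add: coeff0_def fps_expansion_eqI)
qed

lemma coeff0_koebe: "coeff0 koebe n = of_nat n"
  by (rule coeff0_eqI) (rule koebe_sums)

lemma coeff0_odd_koebe: "coeff0 odd_koebe n = (if odd n then of_nat n else 0)"
proof (rule coeff0_eqI)
  fix z :: complex
  assume "norm z < 1"
  then have "(\<lambda>n. (of_nat n * z ^ n - of_nat n * (- z) ^ n) / 2) sums odd_koebe z"
    unfolding odd_koebe_def by (intro sums_divide sums_diff koebe_sums) auto
  moreover have "(of_nat n * z ^ n - of_nat n * (- z) ^ n) / 2 = (if odd n then of_nat n else 0) * z ^ n" for n
    by (simp add: power_minus_odd)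
  ultimately show "(\<lambda>n. (if odd n then of_nat n else 0) * z ^ n) sums odd_koebe z" by simp
qed

lemma Im_koebe: "Im (koebe z) = Im z * (1 - (norm z)\<^sup>2) / (norm (1 - z)) ^ 4"
proof -
  have "koebe z = z * cnj ((1 - z)\<^sup>2) / of_real ((norm ((1 - z)\<^sup>2))\<^sup>2)"
    unfolding koebe_def by (rule complex_div_cnj)
  then have "Im (koebe z) = Im (z * cnj ((1 - z)\<^sup>2)) / (norm (1 - z)) ^ 4"
    by (simp add: norm_power flip: power_mult)
  also have "Im (z * cnj ((1 - z)\<^sup>2)) = Im z * (1 - (norm z)\<^sup>2)"
    unfolding cmod_power2 by (simp add: power2_eq_square algebra_simps)
  finally show ?thesis .
qed

lemma Im_koebe_sign:
  assumes "norm z < 1"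
  shows "sgn (Im (koebe z)) = sgn (Im z)"
proof -
  have "(norm z)\<^sup>2 < 1" "norm (1 - z) > 0"
    using assms by (auto simp: power_less_one_iff abs_square_less_1)
  then show ?thesis by (simp add: Im_koebe sgn_mult sgn_divide)
qed

lemma holomorphic_koebe: "koebe holomorphic_on ball 0 1"
  unfolding koebe_def by (intro holomorphic_intros) auto

lemma koebe_typically_real: "koebe \<in> typically_real"
  using Im_koebe_sign holomorphic_koebe
  by (auto simp: typically_real_def class_A_def coeff0_koebe complex_is_Real_iff sgn_zero_iff)
    (metis sgn_zero_iff)+

lemma odd_koebe_typically_real: "odd_koebe \<in> typically_real"
proof -
  have "odd_koebe holomorphic_on ball 0 1"
    unfolding odd_koebe_def koebe_def
    by (intro holomorphic_intros) (auto simp: add_eq_0_iff)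
  moreover have "Im (odd_koebe z) = 0 \<longleftrightarrow> Im z = 0" if "norm z < 1" for z
    using Im_koebe_sign[of z] Im_koebe_sign[of "- z"] that
    by (auto simp: odd_koebe_def sgn_if split: if_splits)
  ultimately show ?thesis
    by (auto simp: typically_real_def class_A_def coeff0_odd_koebe complex_is_Real_iff)
qed

lemma zalcman_koebe:
  assumes "l \<ge> 1" "n \<ge> 1" "m \<ge> 1"
  shows "norm (zalcman l n m koebe) = l * real m * real n - real n - real m + 1"
proof -
  have "l * (real n * real m) \<ge> 1 * (real n * real m)"
    using assms by (intro mult_right_mono) auto
  moreover have "(real n - 1) * (real m - 1) \<ge> 0"
    using assms by (intro mult_nonneg_nonneg) auto
  ultimately have "l * (real n * real m) - (real n + real m - 1) \<ge> 0"
    by (simp add: algebra_simps)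
  then show ?thesis
    using assms
    by (simp add: norm_zalcman_eq[OF koebe_typically_real] coeff0_koebe of_nat_diff mult_ac)
qed

lemma zalcman_odd_koebe:
  assumes "even n" "even m" "n \<ge> 1"
  shows "norm (zalcman l n m odd_koebe) = real n + real m - 1"
proof -
  have "odd (n + m - 1)" using assms by auto
  then show ?thesis
    using assms by (simp add: norm_zalcman_eq[OF odd_koebe_typically_real] coeff0_odd_koebe of_nat_diff)
qed

section \<open>The generalized Zalcman functional\<close>

lemma zalcman_commute: "zalcman l n m f = zalcman l m n f"
  by (simp add: zalcman_def add.commute)

lemma zalcman_sharp_exceptional:
  fixes l :: real
  assumes "l \<ge> 1" "even m" "m \<ge> 2"
  shows "(l \<le> 3/2 \<longrightarrow>
          (\<forall>f\<in>typically_real. norm (zalcman l 2 m f) \<le> 3 + (2 * l - 1) * (real m - 2)) \<and>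
          (l = 1 \<or> m = 2 \<longrightarrow>
            (\<exists>f\<in>typically_real. norm (zalcman l 2 m f) = 3 + (2 * l - 1) * (real m - 2)))) \<and>
       (l \<ge> 3/2 \<longrightarrow>
          (\<forall>f\<in>typically_real. norm (zalcman l 2 m f) \<le> 2 * l * real m - real m - 1) \<and>
          (\<exists>f\<in>typically_real. norm (zalcman l 2 m f) = 2 * l * real m - real m - 1))"
proof (intro conjI impI ballI)
  fix f assume f: "f \<in> typically_real"
  interpret livingston_coefficients "\<lambda>n. Re (coeff0 f n)" "circle_moment f 1"
    by (rule typically_real_livingston[OF f])
  show "norm (zalcman l 2 m f) \<le> 3 + (2 * l - 1) * (real m - 2)" if "l \<le> 3/2"
    using zalcman_bound_exceptional(1)[OF assms(2,3,1) that] by (simp add: norm_zalcman_eq[OF f])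
  show "norm (zalcman l 2 m f) \<le> 2 * l * real m - real m - 1" if "l \<ge> 3/2"
    using zalcman_bound_exceptional(2)[OF assms(2,3,1) that] by (simp add: norm_zalcman_eq[OF f])
next
  assume "l = 1 \<or> m = 2"
  then show "\<exists>f\<in>typically_real. norm (zalcman l 2 m f) = 3 + (2 * l - 1) * (real m - 2)"
    using assms by (intro bexI[OF _ odd_koebe_typically_real]) (auto simp: zalcman_odd_koebe)
next
  show "\<exists>f\<in>typically_real. norm (zalcman l 2 m f) = 2 * l * real m - real m - 1"
    using assms by (intro bexI[OF _ koebe_typically_real]) (simp add: zalcman_koebe)
qed

lemma zalcman_sharp_generic:
  fixes l :: real
  assumes "l \<ge> 1" "n \<ge> 1" "m \<ge> 1" "\<not> (n = 2 \<and> even m)" "\<not> (m = 2 \<and> even n)"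
  shows "\<forall>f\<in>typically_real. norm (zalcman l n m f) \<le> l * real m * real n - real n - real m + 1"
    and "\<exists>f\<in>typically_real. norm (zalcman l n m f) = l * real m * real n - real n - real m + 1"
proof -
  show "\<forall>f\<in>typically_real. norm (zalcman l n m f) \<le> l * real m * real n - real n - real m + 1"
  proof
    fix f assume f: "f \<in> typically_real"
    interpret livingston_coefficients "\<lambda>n. Re (coeff0 f n)" "circle_moment f 1"
      by (rule typically_real_livingston[OF f])
    show "norm (zalcman l n m f) \<le> l * real m * real n - real n - real m + 1"
      using zalcman_bound_generic[OF assms] by (simp add: norm_zalcman_eq[OF f])
  qed
  show "\<exists>f\<in>typically_real. norm (zalcman l n m f) = l * real m * real n - real n - real m + 1"
    using assms by (intro bexI[OF _ koebe_typically_real] zalcman_koebe) auto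
qed

theorem theorem3p3:
  fixes l :: real and n m :: nat
  assumes "l \<ge> 1" and "n \<ge> 2" and "m \<ge> 2"
  shows
   "(n = 2 \<and> even m \<longrightarrow>
       (l \<le> 3/2 \<longrightarrow>
          (\<forall>f\<in>typically_real. norm (zalcman l n m f) \<le> 3 + (2 * l - 1) * (real m - 2)) \<and>
          (l = 1 \<or> n = 2 \<and> m = 2 \<longrightarrow>
            (\<exists>f\<in>typically_real. norm (zalcman l n m f) = 3 + (2 * l - 1) * (real m - 2)))) \<and>
       (l \<ge> 3/2 \<longrightarrow>
          (\<forall>f\<in>typically_real. norm (zalcman l n m f) \<le> 2 * l * real m - real m - 1) \<and>
          (\<exists>f\<in>typically_real. norm (zalcman l n m f) = 2 * l * real m - real m - 1))) \<and>
    (m = 2 \<and> even n \<longrightarrow>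
       (l \<le> 3/2 \<longrightarrow>
          (\<forall>f\<in>typically_real. norm (zalcman l n m f) \<le> 3 + (2 * l - 1) * (real n - 2)) \<and>
          (l = 1 \<or> n = 2 \<and> m = 2 \<longrightarrow>
            (\<exists>f\<in>typically_real. norm (zalcman l n m f) = 3 + (2 * l - 1) * (real n - 2)))) \<and>
       (l \<ge> 3/2 \<longrightarrow>
          (\<forall>f\<in>typically_real. norm (zalcman l n m f) \<le> 2 * l * real n - real n - 1) \<and>
          (\<exists>f\<in>typically_real. norm (zalcman l n m f) = 2 * l * real n - real n - 1))) \<and>
    (\<not> (n = 2 \<and> even m) \<and> \<not> (m = 2 \<and> even n) \<longrightarrow>
       (\<forall>f\<in>typically_real. norm (zalcman l n m f) \<le> l * real m * real n - real n - real m + 1) \<and>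
       (\<exists>f\<in>typically_real. norm (zalcman l n m f) = l * real m * real n - real n - real m + 1))"
proof (intro conjI)
  show "n = 2 \<and> even m \<longrightarrow>
       (l \<le> 3/2 \<longrightarrow>
          (\<forall>f\<in>typically_real. norm (zalcman l n m f) \<le> 3 + (2 * l - 1) * (real m - 2)) \<and>
          (l = 1 \<or> n = 2 \<and> m = 2 \<longrightarrow>
            (\<exists>f\<in>typically_real. norm (zalcman l n m f) = 3 + (2 * l - 1) * (real m - 2)))) \<and>
       (l \<ge> 3/2 \<longrightarrow>
          (\<forall>f\<in>typically_real. norm (zalcman l n m f) \<le> 2 * l * real m - real m - 1) \<and>
          (\<exists>f\<in>typically_real. norm (zalcman l n m f) = 2 * l * real m - real m - 1))"
    using zalcman_sharp_exceptional[of l m] assms by blast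
  show "m = 2 \<and> even n \<longrightarrow>
       (l \<le> 3/2 \<longrightarrow>
          (\<forall>f\<in>typically_real. norm (zalcman l n m f) \<le> 3 + (2 * l - 1) * (real n - 2)) \<and>
          (l = 1 \<or> n = 2 \<and> m = 2 \<longrightarrow>
            (\<exists>f\<in>typically_real. norm (zalcman l n m f) = 3 + (2 * l - 1) * (real n - 2)))) \<and>
       (l \<ge> 3/2 \<longrightarrow>
          (\<forall>f\<in>typically_real. norm (zalcman l n m f) \<le> 2 * l * real n - real n - 1) \<and>
          (\<exists>f\<in>typically_real. norm (zalcman l n m f) = 2 * l * real n - real n - 1))"
    using zalcman_sharp_exceptional[of l n] assms unfolding zalcman_commute[of l 2 n] by blast
  show "\<not> (n = 2 \<and> even m) \<and> \<not> (m = 2 \<and> even n) \<longrightarrow>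
       (\<forall>f\<in>typically_real. norm (zalcman l n m f) \<le> l * real m * real n - real n - real m + 1) \<and>
       (\<exists>f\<in>typically_real. norm (zalcman l n m f) = l * real m * real n - real n - real m + 1)"
    using zalcman_sharp_generic[of l n m] assms by simp
qed

end
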